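(* Every transitive subsystem of a two-sided substitutive system is a two-sided substitutive system. Every transitive subsystem of a two-sided $k$-automatic system is a two-sided $k$-automatic system.
   Context: For a finite alphabet $\mathcal{A}$, ${}^\omega\mathcal{A}^\omega$ denotes biinfinite sequences $(y_n)_{n\in\mathbb{Z}}$ with product topology and the (invertible) shift $T$; a subsystem is a closed subset invariant under $T$ and $T^{-1}$; it is transitive if it is the closure of the two-sided orbit $\{T^ny:n\in\mathbb{Z}\}$ of one of its points. Substitutions $\varphi\colon\mathcal{A}\to\mathcal{A}^*$ are extended by concatenation and assumed growing ($|\varphi^n(a)|\to\infty$ for all $a$). A one-sided sequence $(x_n)_{n\ge0}$ is substitutive if it is the image under a coding (letter-to-letter map) of a fixed point of a substitution, and $k$-automatic if the substitution can be taken of constant length $k$ ($|\varphi(a)|=k$ for all $a$); a left-infinite sequence $(x_n)_{n<0}$ is substitutive (resp. $k$-automatic) if its reversal $(x_{-1-n})_{n\ge0}$ is. A biinfinite sequence $y$ is (two-sided) substitutive (resp. $k$-automatic) if both $(y_n)_{n\ge0}$ and $(y_n)_{n<0}$ are substitutive (resp. $k$-automatic). A two-sided substitutive (resp. $k$-automatic) system is the two-sided orbit closure of a two-sided substitutive (resp. $k$-automatic) sequence. *)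

theory Defs
  imports "HOL-Analysis.Analysis"
begin

text \<open>Biinfinite sequences over an alphabet \<open>A\<close> are functions on the integers with values in \<open>A\<close>.\<close>

definition full_shift :: "'a set \<Rightarrow> (int \<Rightarrow> 'a) topology" where
  "full_shift A = product_topology (\<lambda>_. discrete_topology A) UNIV"

text \<open>\<open>shift_pow n\<close> is the \<open>n\<close>-th power (\<open>n\<close> an arbitrary integer) of the shift \<open>T\<close>; see
  \<open>funpow_shift\<close> and \<open>funpow_inv_shift\<close> below.\<close>

definition shift :: "(int \<Rightarrow> 'a) \<Rightarrow> int \<Rightarrow> 'a" where
  "shift y = (\<lambda>m. y (m + 1))"

definition shift_pow :: "int \<Rightarrow> (int \<Rightarrow> 'a) \<Rightarrow> int \<Rightarrow> 'a" where
  "shift_pow n y = (\<lambda>m. y (m + n))"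

definition orbit_closure :: "'a set \<Rightarrow> (int \<Rightarrow> 'a) \<Rightarrow> (int \<Rightarrow> 'a) set" where
  "orbit_closure A y = full_shift A closure_of range (\<lambda>n. shift_pow n y)"

definition shift_system :: "'a set \<Rightarrow> (int \<Rightarrow> 'a) set \<Rightarrow> bool" where
  "shift_system A Y \<longleftrightarrow>
     closedin (full_shift A) Y \<and> shift ` Y \<subseteq> Y \<and> inv shift ` Y \<subseteq> Y"

definition subsystem :: "'a set \<Rightarrow> (int \<Rightarrow> 'a) set \<Rightarrow> (int \<Rightarrow> 'a) set \<Rightarrow> bool" where
  "subsystem A Y X \<longleftrightarrow> shift_system A Y \<and> Y \<subseteq> X"

definition transitive_system :: "'a set \<Rightarrow> (int \<Rightarrow> 'a) set \<Rightarrow> bool" where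
  "transitive_system A Y \<longleftrightarrow> (\<exists>y\<in>Y. Y = orbit_closure A y)"

definition subst_word :: "('b \<Rightarrow> 'b list) \<Rightarrow> 'b list \<Rightarrow> 'b list" where
  "subst_word \<phi> w = concat (map \<phi> w)"

definition growing_substitution :: "'b set \<Rightarrow> ('b \<Rightarrow> 'b list) \<Rightarrow> bool" where
  "growing_substitution B \<phi> \<longleftrightarrow>
     (\<forall>b\<in>B. \<phi> b \<in> lists B) \<and>
     (\<forall>b\<in>B. filterlim (\<lambda>n. length ((subst_word \<phi> ^^ n) [b])) at_top sequentially)"

text \<open>The infinite concatenation \<open>\<phi>(z\<^sub>0)\<phi>(z\<^sub>1)\<phi>(z\<^sub>2)\<dots>\<close>. A growing substitution maps no letter to
  the empty word, so the images of the first \<open>i + 1\<close> letters already determine the letter at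
  position \<open>i\<close>.\<close>

definition subst_seq :: "('b \<Rightarrow> 'b list) \<Rightarrow> (nat \<Rightarrow> 'b) \<Rightarrow> nat \<Rightarrow> 'b" where
  "subst_seq \<phi> z = (\<lambda>i. subst_word \<phi> (map z [0..<Suc i]) ! i)"

text \<open>The alphabet \<open>B\<close> of the substitution is unrelated to the alphabet \<open>A\<close> of the coded sequence.
  Since any finite alphabet can be renamed into the natural numbers, its letters are taken there.\<close>

definition substitutive :: "'a set \<Rightarrow> (nat \<Rightarrow> 'a) \<Rightarrow> bool" where
  "substitutive A x \<longleftrightarrow>
     (\<exists>(B::nat set) \<phi> z \<pi>. finite B \<and> growing_substitution B \<phi> \<and>
        range z \<subseteq> B \<and> subst_seq \<phi> z = z \<and> \<pi> ` B \<subseteq> A \<and> x = \<pi> \<circ> z)"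

definition automatic :: "nat \<Rightarrow> 'a set \<Rightarrow> (nat \<Rightarrow> 'a) \<Rightarrow> bool" where
  "automatic k A x \<longleftrightarrow>
     (\<exists>(B::nat set) \<phi> z \<pi>. finite B \<and> growing_substitution B \<phi> \<and>
        (\<forall>b\<in>B. length (\<phi> b) = k) \<and>
        range z \<subseteq> B \<and> subst_seq \<phi> z = z \<and> \<pi> ` B \<subseteq> A \<and> x = \<pi> \<circ> z)"

definition right_half :: "(int \<Rightarrow> 'a) \<Rightarrow> nat \<Rightarrow> 'a" where
  "right_half y = (\<lambda>n. y (int n))"

text \<open>The negative half is read from right to left.\<close>

definition left_half :: "(int \<Rightarrow> 'a) \<Rightarrow> nat \<Rightarrow> 'a" where
  "left_half y = (\<lambda>n. y (- 1 - int n))"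

definition two_sided_substitutive :: "'a set \<Rightarrow> (int \<Rightarrow> 'a) \<Rightarrow> bool" where
  "two_sided_substitutive A y \<longleftrightarrow> substitutive A (right_half y) \<and> substitutive A (left_half y)"

definition two_sided_automatic :: "nat \<Rightarrow> 'a set \<Rightarrow> (int \<Rightarrow> 'a) \<Rightarrow> bool" where
  "two_sided_automatic k A y \<longleftrightarrow> automatic k A (right_half y) \<and> automatic k A (left_half y)"

definition two_sided_substitutive_system :: "'a set \<Rightarrow> (int \<Rightarrow> 'a) set \<Rightarrow> bool" where
  "two_sided_substitutive_system A X \<longleftrightarrow>
     (\<exists>y. two_sided_substitutive A y \<and> X = orbit_closure A y)"

definition two_sided_automatic_system :: "nat \<Rightarrow> 'a set \<Rightarrow> (int \<Rightarrow> 'a) set \<Rightarrow> bool" where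
  "two_sided_automatic_system k A X \<longleftrightarrow>
     (\<exists>y. two_sided_automatic k A y \<and> X = orbit_closure A y)"

lemma topspace_full_shift: "topspace (full_shift A) = {y. range y \<subseteq> A}"
  by (auto simp: full_shift_def)

lemma inv_shift: "inv shift = shift_pow (- 1)"
  by (rule inv_unique_comp) (auto simp: shift_def shift_pow_def fun_eq_iff)

lemma funpow_shift: "shift ^^ n = shift_pow (int n)"
  by (induction n) (auto simp: shift_def shift_pow_def fun_eq_iff algebra_simps)

lemma funpow_inv_shift: "inv shift ^^ n = shift_pow (- int n)"
  by (induction n) (auto simp: inv_shift shift_pow_def fun_eq_iff algebra_simps)

lemma growing_substitution_nonempty:
  assumes "growing_substitution B \<phi>" "b \<in> B"
  shows "\<phi> b \<noteq> []"
proof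
  assume e: "\<phi> b = []"
  have "(subst_word \<phi> ^^ Suc n) [b] = []" for n
    by (induction n) (auto simp: subst_word_def e)
  moreover have "filterlim (\<lambda>n. length ((subst_word \<phi> ^^ n) [b])) at_top sequentially"
    using assms by (auto simp: growing_substitution_def)
  then obtain N where "\<forall>n\<ge>N. 1 \<le> length ((subst_word \<phi> ^^ n) [b])"
    by (auto simp: filterlim_at_top eventually_sequentially)
  then have "1 \<le> length ((subst_word \<phi> ^^ Suc N) [b])"
    using le_SucI by blast
  ultimately show False by simp
qed

lemma two_sided_substitutive_in_full_shift:
  assumes "two_sided_substitutive A y"
  shows "y \<in> topspace (full_shift A)"
proof -
  have *: "x n \<in> A" if "substitutive A x" for x n
    using that unfolding substitutive_def by (metis comp_apply imageI range_subsetD subsetD)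
  have "y n \<in> A" for n
  proof (cases "n \<ge> 0")
    case True
    then show ?thesis
      using *[of "right_half y" "nat n"] assms
      by (simp add: two_sided_substitutive_def right_half_def)
  next
    case False
    then show ?thesis
      using *[of "left_half y" "nat (- 1 - n)"] assms
      by (simp add: two_sided_substitutive_def left_half_def)
  qed
  then show ?thesis by (auto simp: topspace_full_shift)
qed

end

theory Submission
  imports Defs
begin

text \<open>
  Let \<open>y\<close> be two-sided substitutive and let \<open>x\<close> lie in its orbit closure. Either \<open>x\<close> is a shift of
  \<open>y\<close>, or \<open>x\<close> is a limit of shifts of \<open>y\<close> that escape to \<open>+\<infinity>\<close> or, after reflection, to \<open>-\<infinity>\<close>. In
  the latter cases only one half \<open>\<pi>(z)\<close> of \<open>y\<close> matters, with \<open>z\<close> a fixed point of \<open>\<phi>\<close>. For each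
  \<open>n\<close>, the occurrences in \<open>z\<close> of ever larger central windows of \<open>x\<close> are covered around their centre
  by \<open>\<phi>\<^sup>n(t\<^sub>n)\<close> with \<open>t\<^sub>n\<close> a factor of \<open>z\<close> of length three; a diagonal argument makes the \<open>t\<^sub>n\<close>
  compatible, so that \<open>t\<^sub>n\<close> lies strictly inside \<open>\<phi>\<^sup>d(t\<^bsub>n+d\<^esub>)\<close> for large \<open>d\<close>. By the pigeonhole
  principle \<open>\<phi>\<^sup>p(t) = utv\<close> with \<open>t = t\<^sub>n\<close> for infinitely many \<open>n\<close> in one residue class modulo \<open>p\<close>,
  and \<open>x\<close> has the same factors as the image under \<open>\<pi>\<close> of a two-sided \<open>W\<close> that \<open>\<phi>\<^sup>p\<close> fixes up to a
  shift. Recoding \<open>W\<close> by its windows of a sufficiently large radius absorbs the shift, so both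
  halves of \<open>W\<close> are codings of fixed points of substitutions with the same lengths as \<open>\<phi>\<^sup>p\<close>. In
  the automatic case these lengths are \<open>k\<^sup>p\<close>, and \<open>k\<^sup>p\<close>-automatic sequences are \<open>k\<close>-automatic.
\<close>

section \<open>Powers of substitutions\<close>

lemma upt_split: "a \<le> b \<Longrightarrow> b \<le> c \<Longrightarrow> [a..<c] = [a..<b] @ [b..<c]"
  using upt_add_eq_append[of a b "c - b"] by simp

lemma subst_word_Nil: "subst_word \<phi> [] = []"
  by (simp add: subst_word_def)

lemma subst_word_Cons: "subst_word \<phi> (a # w) = \<phi> a @ subst_word \<phi> w"
  by (simp add: subst_word_def)

lemma subst_word_append: "subst_word \<phi> (u @ v) = subst_word \<phi> u @ subst_word \<phi> v"
  by (simp add: subst_word_def)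

lemma subst_pow_append:
  "(subst_word \<phi> ^^ n) (u @ v) = (subst_word \<phi> ^^ n) u @ (subst_word \<phi> ^^ n) v"
  by (induction n) (auto simp: subst_word_append)

lemma subst_pow_Nil: "(subst_word \<phi> ^^ n) [] = []"
  by (induction n) (auto simp: subst_word_def)

text \<open>This turns a power of \<open>\<phi>\<close> into a substitution in its own right, so
  facts about a single application carry over to powers.\<close>

lemma subst_word_of_pow: "subst_word (\<lambda>b. (subst_word \<phi> ^^ p) [b]) w = (subst_word \<phi> ^^ p) w"
proof (induction w)
  case (Cons a w)
  then show ?case
    using subst_pow_append[of p \<phi> "[a]" w] by (simp add: subst_word_Cons)
qed (simp_all add: subst_word_Nil subst_pow_Nil)

lemma subst_pow_of_pow:
  "(subst_word (\<lambda>b. (subst_word \<phi> ^^ p) [b]) ^^ j) w = (subst_word \<phi> ^^ (p * j)) w"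
proof (induction j)
  case (Suc j)
  have "p * Suc j = p + p * j"
    by simp
  then show ?case
    using Suc by (simp only: funpow_add) (simp add: subst_word_of_pow)
qed simp

lemma subst_pow_in_lists:
  assumes "\<And>b. b \<in> B \<Longrightarrow> \<phi> b \<in> lists B" "w \<in> lists B"
  shows "(subst_word \<phi> ^^ n) w \<in> lists B"
proof (induction n)
  case (Suc n)
  have "subst_word \<phi> v \<in> lists B" if "v \<in> lists B" for v
    using that assms(1) by (fastforce simp: subst_word_def)
  then show ?case
    using Suc by simp
qed (use assms in simp)

lemma length_subst_word_ge:
  assumes "\<And>b. b \<in> B \<Longrightarrow> c \<le> length (\<phi> b)" "w \<in> lists B"
  shows "c * length w \<le> length (subst_word \<phi> w)"
  using assms(2)
proof (induction w)
  case (Cons a w)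
  then show ?case
    using assms(1)[of a] by (simp add: subst_word_def)
qed simp

lemma length_subst_pow_ge:
  assumes "\<And>b. b \<in> B \<Longrightarrow> c \<le> length ((subst_word \<phi> ^^ n) [b])" "w \<in> lists B"
  shows "c * length w \<le> length ((subst_word \<phi> ^^ n) w)"
  using length_subst_word_ge[of B c "\<lambda>b. (subst_word \<phi> ^^ n) [b]" w] assms
  by (simp add: subst_word_of_pow)

lemma growing_substitution_uniform:
  assumes "growing_substitution B \<phi>" "finite B"
  shows "\<exists>N. \<forall>n\<ge>N. \<forall>b\<in>B. c \<le> length ((subst_word \<phi> ^^ n) [b])"
proof -
  have "\<forall>b\<in>B. \<forall>\<^sub>F n in sequentially. c \<le> length ((subst_word \<phi> ^^ n) [b])"
    using assms(1) by (auto simp: growing_substitution_def filterlim_at_top)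
  then have "\<forall>\<^sub>F n in sequentially. \<forall>b\<in>B. c \<le> length ((subst_word \<phi> ^^ n) [b])"
    using assms(2) by (simp add: eventually_ball_finite)
  then show ?thesis
    by (simp add: eventually_sequentially)
qed

lemma growing_substitutionI:
  assumes "\<And>b. b \<in> B \<Longrightarrow> \<psi> b \<in> lists B" "\<And>b. b \<in> B \<Longrightarrow> 2 \<le> length (\<psi> b)"
  shows "growing_substitution B \<psi>"
  unfolding growing_substitution_def
proof (intro conjI ballI)
  fix b assume b: "b \<in> B"
  have "2 ^ n \<le> length ((subst_word \<psi> ^^ n) [b])" for n
  proof (induction n)
    case (Suc n)
    have "(subst_word \<psi> ^^ n) [b] \<in> lists B"
      using subst_pow_in_lists[of B \<psi> "[b]" n] assms(1) b by simp
    then show ?case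
      using length_subst_word_ge[of B 2 \<psi> "(subst_word \<psi> ^^ n) [b]"] assms(2) Suc by simp
  qed simp
  then have "n \<le> length ((subst_word \<psi> ^^ n) [b])" for n
    by (meson less_exp less_imp_le order_trans)
  then show "filterlim (\<lambda>n. length ((subst_word \<psi> ^^ n) [b])) at_top sequentially"
    by (intro filterlim_at_top_mono[OF filterlim_ident]) auto
qed (use assms in auto)

section \<open>Self-similar sequences\<close>

text \<open>The predicate \<open>Q\<close> on the lengths of the images of letters covers substitutive and
  \<open>k\<close>-automatic sequences at the same time.\<close>

definition presented :: "(nat \<Rightarrow> bool) \<Rightarrow> 'a set \<Rightarrow> (nat \<Rightarrow> 'a) \<Rightarrow> bool" where
  "presented Q A x \<longleftrightarrow>
     (\<exists>(B::nat set) \<phi> z \<pi>. finite B \<and> growing_substitution B \<phi> \<and>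
        (\<forall>b\<in>B. Q (length (\<phi> b))) \<and>
        range z \<subseteq> B \<and> subst_seq \<phi> z = z \<and> \<pi> ` B \<subseteq> A \<and> x = \<pi> \<circ> z)"

lemma substitutive_iff_presented: "substitutive A x \<longleftrightarrow> presented (\<lambda>_. True) A x"
  by (simp add: substitutive_def presented_def)

lemma automatic_iff_presented: "automatic k A x \<longleftrightarrow> presented (\<lambda>l. l = k) A x"
  by (simp add: automatic_def presented_def)

text \<open>The values of \<open>v\<close> serve as letters. By \<open>step\<close>, the block of
  \<open>v\<close> of length \<open>L n\<close> from \<open>h n\<close> on depends only on the
  letter \<open>v n\<close>, so it can be taken as the image of that letter. As
  \<open>h 0 = 0\<close>, these blocks tile the naturals from 0 on, which makes \<open>v\<close> a
  genuine fixed point.\<close>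

lemma presented_of_self_similar:
  fixes v :: "nat \<Rightarrow> 'c" and x :: "nat \<Rightarrow> 'a"
  assumes fin: "finite (range v)"
    and h0: "h 0 = 0" and hS: "\<And>n. h (Suc n) = h n + L n"
    and L2: "\<And>n. 2 \<le> L n" and QL: "\<And>n. Q (L n)"
    and L: "\<And>n m. v n = v m \<Longrightarrow> L n = L m"
    and step: "\<And>n m r. v n = v m \<Longrightarrow> r < L n \<Longrightarrow> v (h n + r) = v (h m + r)"
    and xA: "\<And>n. x n \<in> A" and x: "\<And>n m. v n = v m \<Longrightarrow> x n = x m"
  shows "presented Q A x"
proof -
  obtain e :: "'c \<Rightarrow> nat" where e: "inj_on e (range v)"
    using finite_imp_inj_to_nat_seg[OF fin] by blast
  define z where "z n = e (v n)" for n
  have z_eq: "z n = z m \<longleftrightarrow> v n = v m" for n m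
    using e by (auto simp: z_def inj_on_def)
  \<comment> \<open>Any position carrying a letter may define its image and its code;
    \<open>L\<close>, \<open>step\<close> and \<open>x\<close> make the choice immaterial.\<close>
  define idx where "idx b = (SOME n. z n = b)" for b
  have idx: "v (idx (z n)) = v n" for n
    using someI[of "\<lambda>m. z m = z n" n] by (simp add: idx_def z_eq)
  define \<phi> where "\<phi> b = map (\<lambda>r. z (h (idx b) + r)) [0..<L (idx b)]" for b
  define \<pi> where "\<pi> b = x (idx b)" for b
  have phi: "\<phi> (z n) = map z [h n..<h (Suc n)]" for n
  proof (rule nth_equalityI)
    show len: "length (\<phi> (z n)) = length (map z [h n..<h (Suc n)])"
      using L[OF idx, of n] by (simp add: \<phi>_def hS)
    fix r assume "r < length (\<phi> (z n))"
    then have r: "r < L n"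
      using len by (simp add: hS)
    then show "\<phi> (z n) ! r = map z [h n..<h (Suc n)] ! r"
      using L[OF idx, of n] step[OF idx, of r n] by (simp add: \<phi>_def hS z_eq)
  qed
  have le: "h n \<le> h (Suc n)" for n
    by (simp add: hS)
  have ge: "n \<le> h n" for n
  proof (induction n)
    case (Suc n)
    then show ?case
      using L2[of n] by (simp add: hS)
  qed simp
  have word: "subst_word \<phi> (map z [0..<n]) = map z [0..<h n]" for n
  proof (induction n)
    case (Suc n)
    have "map z [0..<h (Suc n)] = map z [0..<h n] @ map z [h n..<h (Suc n)]"
      using le[of n] by (simp add: upt_split[of 0 "h n" "h (Suc n)"])
    then show ?case
      using Suc by (simp add: subst_word_append) (simp add: subst_word_def phi)
  qed (simp add: subst_word_def h0)
  have "subst_seq \<phi> z = z"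
  proof
    fix i
    \<comment> \<open>\<open>subst_seq\<close> reads letter \<open>i\<close> in the image of the
      first \<open>i + 1\<close> letters, so that image must be longer than
      \<open>i\<close>.\<close>
    have "i < h (Suc i)"
      using ge[of "Suc i"] by simp
    then show "subst_seq \<phi> z i = z i"
      unfolding subst_seq_def word by simp
  qed
  moreover have "growing_substitution (range z) \<phi>"
    by (rule growing_substitutionI) (use L2 in \<open>auto simp: \<phi>_def\<close>)
  moreover have "finite (range z)"
    using finite_imageI[OF fin, of e] by (simp add: z_def image_image)
  moreover have "x = \<pi> \<circ> z"
    using x[OF idx] by (auto simp: \<pi>_def)
  moreover have "\<forall>b\<in>range z. Q (length (\<phi> b))" "\<pi> ` range z \<subseteq> A"
    using QL xA by (auto simp: \<phi>_def \<pi>_def)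
  ultimately show ?thesis
    unfolding presented_def by blast
qed

lemma block_containing:
  fixes g :: "int \<Rightarrow> int"
  assumes "a \<le> b" "g a \<le> d" "d < g b"
  shows "\<exists>j. a \<le> j \<and> j < b \<and> g j \<le> d \<and> d < g (j + 1)"
  using assms
proof (induction "nat (b - a)" arbitrary: b)
  case (Suc m)
  show ?case
  proof (cases "g (b - 1) \<le> d")
    case True
    with Suc show ?thesis by (intro exI[of _ "b - 1"]) auto
  next
    case False
    have "\<exists>j. a \<le> j \<and> j < b - 1 \<and> g j \<le> d \<and> d < g (j + 1)"
      using Suc(2) False Suc.prems by (intro Suc(1)) auto
    then show ?thesis by force
  qed
qed auto

text \<open>Here \<open>g i\<close> is the position in \<open>W\<close> where the image of the \<open>i\<close>-th letter starts, so
  \<open>\<psi>(W)\<close> is \<open>W\<close> shifted by \<open>g 0\<close>. Since images of letters have length at least 2, a window of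
  radius \<open>\<bar>g 0\<bar>\<close> determines windows of the same radius in the image, even after shifting by \<open>g 0\<close>.\<close>

lemma presented_right_half:
  fixes W :: "int \<Rightarrow> 'b" and g :: "int \<Rightarrow> int"
  assumes fin: "finite B" and WB: "\<And>i. W i \<in> B"
    and g: "\<And>i. g (i + 1) = g i + int (length (\<psi> (W i)))"
    and W: "\<And>i r. r < length (\<psi> (W i)) \<Longrightarrow> W (g i + int r) = \<psi> (W i) ! r"
    and len: "\<And>i. 2 \<le> length (\<psi> (W i))" and Q: "\<And>i. Q (length (\<psi> (W i)))"
    and \<pi>: "\<pi> ` B \<subseteq> A"
  shows "presented Q A (right_half (\<pi> \<circ> W))"
proof -
  define J where "J = \<bar>g 0\<bar>"
  define v where "v n = map (\<lambda>j. W (int n + j)) [-J..J]" for n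
  \<comment> \<open>Subtracting \<open>g 0\<close> gives the required \<open>h 0 = 0\<close>.
    Positions are then off by \<open>g 0\<close> from the images of the letters, and the windows
    compensate for that.\<close>
  define h where "h n = nat (g (int n) - g 0)" for n
  have growth: "2 * int d \<le> g (i + int d) - g i" for i d
  proof (induction d)
    case (Suc d)
    then show ?case
      using g[of "i + int d"] len[of "i + int d"] by (simp add: algebra_simps)
  qed simp
  have v_eq: "v n = v m \<longleftrightarrow> (\<forall>j. -J \<le> j \<and> j \<le> J \<longrightarrow> W (int n + j) = W (int m + j))" for n m
    by (auto simp: v_def)
  have h: "int (h n) = g (int n) - g 0" for n
    using growth[of n 0] by (simp add: h_def)
  have v0: "W (int n) = W (int m)" if "v n = v m" for n m
    using that[unfolded v_eq, rule_format, of 0] by (simp add: J_def)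
  have step: "v (h n + r) = v (h m + r)" if eq: "v n = v m" and r: "r < length (\<psi> (W (int n)))" for n m r
    unfolding v_eq
  proof (intro allI impI)
    fix j assume j: "-J \<le> j \<and> j \<le> J"
    \<comment> \<open>Equal letters have images of equal length, so equal windows have equal
      distances between cut points. The range ends at \<open>2 * J + 1\<close> to include the right
      end of the last image.\<close>
    have sync: "g (int n - J + int d) - g (int n - J) = g (int m - J + int d) - g (int m - J)"
      if "int d \<le> 2 * J + 1" for d
      using that
    proof (induction d)
      case (Suc d)
      have "W (int n - J + int d) = W (int m - J + int d)"
        using eq[unfolded v_eq, rule_format, of "int d - J"] Suc.prems by (simp add: algebra_simps)
      then show ?case
        using Suc g[of "int n - J + int d"] g[of "int m - J + int d"] by (simp add: algebra_simps)
    qed simp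
    have sync': "g (int n + i) - g (int n) = g (int m + i) - g (int m)" if "-J \<le> i" "i \<le> J + 1" for i
      using sync[of "nat (i + J)"] sync[of "nat J"] that by (simp add: J_def)
    \<comment> \<open>Position \<open>h n + r + j\<close> is \<open>g n + d\<close>, at most
      \<open>2 * J\<close> letters outside the image of \<open>W n\<close>. Since \<open>J\<close>
      images on either side have total length at least \<open>2 * J\<close>, it lies in the image of
      some \<open>W (n + i)\<close> with \<open>\<bar>i\<bar> \<le> J\<close>.\<close>
    define d where "d = j + int r - g 0"
    have "g (int n - J) \<le> g (int n) + d"
      using growth[of "nat J" "int n - J"] j unfolding d_def J_def by simp linarith
    moreover have "g (int n) + d < g (int n + J + 1)"
      using growth[of "nat J" "int n + 1"] j r g[of "int n"] unfolding d_def J_def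
      by (simp add: algebra_simps) linarith
    ultimately obtain a where a: "int n - J \<le> a" "a < int n + J + 1" "g a \<le> g (int n) + d"
      "g (int n) + d < g (a + 1)"
      using block_containing[of "int n - J" "int n + J + 1" g "g (int n) + d"]
      by (auto simp: J_def)
    define i where "i = a - int n"
    have Wi: "W (int n + i) = W (int m + i)"
      using a eq[unfolded v_eq, rule_format, of i] by (simp add: i_def)
    have gi: "g (int n + i) - g (int n) = g (int m + i) - g (int m)"
      using a by (intro sync') (auto simp: i_def)
    define s where "s = nat (g (int n) + d - g a)"
    have s: "s < length (\<psi> (W (int n + i)))" "g (int n) + d = g (int n + i) + int s"
      "g (int m) + d = g (int m + i) + int s"
      using a g[of a] gi by (auto simp: s_def i_def)
    have "W (g (int n) + d) = W (g (int m) + d)"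
      using W[of s "int n + i"] W[of s "int m + i"] s Wi by simp
    then show "W (int (h n + r) + j) = W (int (h m + r) + j)"
      by (simp add: h d_def algebra_simps)
  qed
  have "finite (range v)"
  proof (rule finite_subset)
    show "range v \<subseteq> {l. set l \<subseteq> B \<and> length l = length [-J..J]}"
      using WB by (auto simp: v_def)
  qed (use fin finite_lists_length_eq in blast)
  then show ?thesis
  proof (rule presented_of_self_similar[where h = h and L = "\<lambda>n. length (\<psi> (W (int n)))"])
    show "h (Suc n) = h n + length (\<psi> (W (int n)))" for n
    proof -
      have "int (h (Suc n)) = int (h n + length (\<psi> (W (int n))))"
        using g[of "int n"] by (simp add: h algebra_simps)
      then show ?thesis by linarith
    qed
    show "right_half (\<pi> \<circ> W) n = right_half (\<pi> \<circ> W) m" if "v n = v m" for n m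
      using v0[OF that] by (simp add: right_half_def)
    show "right_half (\<pi> \<circ> W) n \<in> A" for n
      using \<pi> WB by (auto simp: right_half_def)
    show "length (\<psi> (W (int n))) = length (\<psi> (W (int m)))" if "v n = v m" for n m
      using v0[OF that] by simp
  qed (fact len Q step | simp add: h_def)+
qed

text \<open>Reflection \<open>i \<mapsto> - 1 - i\<close> reduces this to the right half, with all
  images reversed. The image of \<open>W (- 1 - i)\<close> ends just before \<open>g (- i)\<close>,
  so after reflection it starts at \<open>- g (- i)\<close>.\<close>

lemma presented_left_half:
  fixes W :: "int \<Rightarrow> 'b" and g :: "int \<Rightarrow> int"
  assumes fin: "finite B" and WB: "\<And>i. W i \<in> B"
    and g: "\<And>i. g (i + 1) = g i + int (length (\<psi> (W i)))"
    and W: "\<And>i r. r < length (\<psi> (W i)) \<Longrightarrow> W (g i + int r) = \<psi> (W i) ! r"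
    and len: "\<And>i. 2 \<le> length (\<psi> (W i))" and Q: "\<And>i. Q (length (\<psi> (W i)))"
    and \<pi>: "\<pi> ` B \<subseteq> A"
  shows "presented Q A (left_half (\<pi> \<circ> W))"
proof -
  define V where "V i = W (- 1 - i)" for i
  have "presented Q A (right_half (\<pi> \<circ> V))"
  proof (rule presented_right_half[where \<psi> = "\<lambda>b. rev (\<psi> b)" and g = "\<lambda>i. - g (- i)"])
    show "- g (- (i + 1)) = - g (- i) + int (length (rev (\<psi> (V i))))" for i
    proof -
      have i: "- (i + 1) = - 1 - i"
        by simp
      show ?thesis
        unfolding i using g[of "- 1 - i"] by (simp add: V_def)
    qed
    show "V (- g (- i) + int r) = rev (\<psi> (V i)) ! r" if "r < length (rev (\<psi> (V i)))" for i r
    proof -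
      let ?l = "length (\<psi> (W (- 1 - i)))"
      have r: "r < ?l"
        using that by (simp add: V_def)
      have "V (- g (- i) + int r) = W (g (- 1 - i) + int (?l - Suc r))"
        using g[of "- 1 - i"] r by (simp add: V_def of_nat_diff algebra_simps)
      then show ?thesis
        using W[of "?l - Suc r" "- 1 - i"] r by (simp add: V_def rev_nth)
    qed
  qed (use assms in \<open>auto simp: V_def\<close>)
  moreover have "right_half (\<pi> \<circ> V) = left_half (\<pi> \<circ> W)"
    by (simp add: right_half_def left_half_def V_def fun_eq_iff)
  ultimately show ?thesis by simp
qed

section \<open>Two-sided sequences fixed by a substitution up to a shift\<close>

text \<open>Finite words that extend one another on both sides have a two-sided limit:
  \<open>c j\<close> is the index of the origin in the \<open>j\<close>-th word, and
  \<open>l j\<close> entries are prepended in the next step. Entries are of any type because the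
  lemma is applied both to letters and to cut points.\<close>

lemma nested_limit:
  fixes c len :: "nat \<Rightarrow> nat" and f :: "nat \<Rightarrow> nat \<Rightarrow> 'x"
  assumes "\<And>j r. r < len j \<Longrightarrow> r + l j < len (Suc j) \<and> f (Suc j) (r + l j) = f j r"
    and "\<And>j. c (Suc j) = c j + l j"
  shows "\<exists>F :: int \<Rightarrow> 'x. \<forall>j r. r < len j \<longrightarrow> F (int r - int (c j)) = f j r"
proof -
  have lift: "\<exists>r'. r' < len (j + d) \<and> int r' - int (c (j + d)) = int r - int (c j) \<and> f (j + d) r' = f j r"
    if "r < len j" for j d r
  proof (induction d)
    case (Suc d)
    then obtain r' where "r' < len (j + d)" "int r' - int (c (j + d)) = int r - int (c j)"
      "f (j + d) r' = f j r" by blast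
    then show ?case
      using assms(1)[of r' "j + d"] assms(2)[of "j + d"] by (intro exI[of _ "r' + l (j + d)"]) auto
  qed (use that in auto)
  have uniq: "f j r = f j' r'"
    if r: "r < len j" and r': "r' < len j'" and eq: "int r - int (c j) = int r' - int (c j')" for j j' r r'
  proof -
    obtain a where a: "int a - int (c (j + j')) = int r - int (c j)" "f (j + j') a = f j r"
      using lift[OF r, of j'] by blast
    obtain b where b: "int b - int (c (j' + j)) = int r' - int (c j')" "f (j' + j) b = f j' r'"
      using lift[OF r', of j] by blast
    have "a = b"
      using a(1) b(1) eq by (simp add: add.commute)
    with a(2) b(2) show ?thesis by (simp add: add.commute)
  qed
  define F where "F i = (SOME y. \<exists>j r. r < len j \<and> int r - int (c j) = i \<and> y = f j r)" for i
  have "F (int r - int (c j)) = f j r" if "r < len j" for j r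
    unfolding F_def using that uniq by (intro some_equality) blast+
  then show ?thesis by blast
qed

text \<open>Iterating \<open>subst_word \<psi> t = u @ t @ v\<close>, the word
  \<open>\<psi>^(j+1)(t)\<close> is \<open>\<psi>^j(t)\<close> with \<open>\<psi>^j(u)\<close> in
  front and \<open>\<psi>^j(v)\<close> behind. As \<open>u\<close> and \<open>v\<close> are
  nonempty, these words exhaust the integers. The origin is kept at the start of the original
  \<open>t\<close>, which lies at index \<open>c j\<close> of \<open>\<psi>^j(t)\<close>.\<close>

lemma two_sided_fixed_point:
  fixes \<psi> :: "'b \<Rightarrow> 'b list"
  assumes \<psi>B: "\<And>b. b \<in> B \<Longrightarrow> \<psi> b \<in> lists B" and ne: "\<And>b. b \<in> B \<Longrightarrow> \<psi> b \<noteq> []"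
    and t: "t \<in> lists B" and utv: "subst_word \<psi> t = u @ t @ v" and u: "u \<noteq> []" and v: "v \<noteq> []"
  obtains W :: "int \<Rightarrow> 'b" and g :: "int \<Rightarrow> int" and c :: "nat \<Rightarrow> nat" where "\<And>i. W i \<in> B"
    "\<And>i. g (i + 1) = g i + int (length (\<psi> (W i)))"
    "\<And>i r. r < length (\<psi> (W i)) \<Longrightarrow> W (g i + int r) = \<psi> (W i) ! r"
    "\<And>j::nat. j \<le> c j"
    "\<And>j. c j + j \<le> length ((subst_word \<psi> ^^ j) t)"
    "\<And>j r. r < length ((subst_word \<psi> ^^ j) t) \<Longrightarrow> W (int r - int (c j)) = (subst_word \<psi> ^^ j) t ! r"
proof -
  let ?\<sigma> = "subst_word \<psi>"
  define s where "s j = (?\<sigma> ^^ j) t" for j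
  define l where "l j = length ((?\<sigma> ^^ j) u)" for j
  define c where "c j = (\<Sum>i<j. l i)" for j
  have uvB: "u \<in> lists B" "v \<in> lists B"
    using subst_pow_in_lists[of B \<psi> t 1] \<psi>B t utv by auto
  have nonerasing: "1 \<le> length ((?\<sigma> ^^ j) w)" if "w \<in> lists B" "w \<noteq> []" for j w
  proof (induction j)
    case (Suc j)
    have "1 * length ((?\<sigma> ^^ j) w) \<le> length (?\<sigma> ((?\<sigma> ^^ j) w))"
    proof (rule length_subst_word_ge)
      show "(?\<sigma> ^^ j) w \<in> lists B" using that \<psi>B by (intro subst_pow_in_lists)
    qed (use ne in \<open>simp add: Suc_leI\<close>)
    then show ?case using Suc by simp
  qed (use that in \<open>simp add: Suc_leI\<close>)
  have sS: "s (Suc j) = (?\<sigma> ^^ j) u @ s j @ (?\<sigma> ^^ j) v" for j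
  proof -
    have "s (Suc j) = (?\<sigma> ^^ j) (?\<sigma> t)"
      unfolding s_def by (simp add: funpow_swap1)
    then show ?thesis by (simp add: utv subst_pow_append s_def)
  qed
  have sS': "s (Suc j) = ?\<sigma> (s j)" for j
    by (simp add: s_def)
  have c_ge: "j \<le> c j" for j
  proof (induction j)
    case (Suc j)
    then show ?case
      using nonerasing[OF uvB(1) u, of j] by (simp add: c_def l_def)
  qed simp
  have len_ge: "c j + j \<le> length (s j)" for j
  proof (induction j)
    case (Suc j)
    then show ?case
      using nonerasing[OF uvB(2) v, of j] by (simp add: c_def l_def sS)
  qed (simp add: c_def)
  have cS: "c (Suc j) = c j + l j" for j
    by (simp add: c_def)
  have "\<exists>W. \<forall>j r. r < length (s j) \<longrightarrow> W (int r - int (c j)) = s j ! r"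
    by (rule nested_limit[where l = l]) (auto simp: cS sS l_def nth_append)
  then obtain W where W: "\<And>j r. r < length (s j) \<Longrightarrow> W (int r - int (c j)) = s j ! r"
    by blast
  have "\<exists>g. \<forall>j r. r < Suc (length (s j)) \<longrightarrow> g (int r - int (c j)) =
      int (length (?\<sigma> (take r (s j)))) - int (c (Suc j))"
  proof (rule nested_limit[where l = l])
    fix j r assume "r < Suc (length (s j))"
    moreover from this have "?\<sigma> (take (r + l j) (s (Suc j))) = (?\<sigma> ^^ Suc j) u @ ?\<sigma> (take r (s j))"
      by (simp add: sS l_def subst_word_append)
    ultimately show "r + l j < Suc (length (s (Suc j))) \<and>
        int (length (?\<sigma> (take (r + l j) (s (Suc j))))) - int (c (Suc (Suc j))) =
        int (length (?\<sigma> (take r (s j)))) - int (c (Suc j))"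
      by (simp add: cS[of "Suc j"] l_def sS)
  qed (rule cS)
  then obtain g where g: "\<And>j r. r \<le> length (s j) \<Longrightarrow>
      g (int r - int (c j)) = int (length (?\<sigma> (take r (s j)))) - int (c (Suc j))"
    by (auto simp: less_Suc_eq_le)
  have cover: "\<exists>j r. r < length (s j) \<and> i = int r - int (c j)" for i
  proof -
    define j where "j = Suc (nat \<bar>i\<bar>)"
    have "\<bar>i\<bar> < int j"
      by (simp add: j_def)
    then have "nat (i + int (c j)) < length (s j) \<and> i = int (nat (i + int (c j))) - int (c j)"
      using c_ge[of j] len_ge[of j] by linarith
    then show ?thesis by blast
  qed
  have sB: "s j \<in> lists B" for j
    unfolding s_def using \<psi>B t by (intro subst_pow_in_lists)
  have split: "?\<sigma> (s j) = ?\<sigma> (take r (s j)) @ \<psi> (s j ! r) @ ?\<sigma> (drop (Suc r) (s j))"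
    "?\<sigma> (take (Suc r) (s j)) = ?\<sigma> (take r (s j)) @ \<psi> (s j ! r)" if "r < length (s j)" for j r
  proof -
    have "?\<sigma> (s j) = ?\<sigma> (take r (s j) @ [s j ! r] @ drop (Suc r) (s j))"
      using id_take_nth_drop[OF that] by simp
    then show "?\<sigma> (s j) = ?\<sigma> (take r (s j)) @ \<psi> (s j ! r) @ ?\<sigma> (drop (Suc r) (s j))"
      by (simp only: subst_word_append) (simp add: subst_word_def)
    show "?\<sigma> (take (Suc r) (s j)) = ?\<sigma> (take r (s j)) @ \<psi> (s j ! r)"
      using that by (simp add: take_Suc_conv_app_nth subst_word_append) (simp add: subst_word_def)
  qed
  show thesis
  proof (rule that[of W g c])
    fix i
    obtain j r where r: "r < length (s j)" and i: "i = int r - int (c j)"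
      using cover by blast
    have Wi: "W i = s j ! r"
      using W[OF r] i by simp
    show "W i \<in> B"
      using sB[of j] r by (auto simp: Wi)
    have gi: "g i = int (length (?\<sigma> (take r (s j)))) - int (c (Suc j))"
      using g[of r j] r i by simp
    show "g (i + 1) = g i + int (length (\<psi> (W i)))"
      using g[of "Suc r" j] r by (simp add: gi Wi split) (simp add: i algebra_simps)
    show "W (g i + int q) = \<psi> (W i) ! q" if "q < length (\<psi> (W i))" for q
      using W[of "length (?\<sigma> (take r (s j))) + q" "Suc j"] that r
      by (simp add: sS' split Wi nth_append gi algebra_simps)
  qed (fact c_ge len_ge[unfolded s_def] W[unfolded s_def])+
qed

section \<open>Windows, limits at infinity and a diagonal argument\<close>

text \<open>Combinatorial form of membership in the orbit closure; see
  \<open>orbit_closure_iff\<close>.\<close>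

definition windows_in :: "(int \<Rightarrow> 'a) \<Rightarrow> (int \<Rightarrow> 'a) \<Rightarrow> bool" where
  "windows_in x y \<longleftrightarrow> (\<forall>m::nat. \<exists>q. \<forall>i. \<bar>i\<bar> \<le> int m \<longrightarrow> x i = y (q + i))"

text \<open>The bound \<open>q \<ge> m\<close> sends the occurrences to infinity and keeps
  \<open>int q + i\<close> nonnegative, so \<open>nat\<close> truncates nothing.\<close>

definition limit_at_infinity :: "(int \<Rightarrow> 'a) \<Rightarrow> (nat \<Rightarrow> 'a) \<Rightarrow> bool" where
  "limit_at_infinity y x \<longleftrightarrow>
     (\<forall>m::nat. \<exists>q\<ge>m. \<forall>i. \<bar>i\<bar> \<le> int m \<longrightarrow> y i = x (nat (int q + i)))"

text \<open>The pigeonhole principle gives a decreasing chain of infinite sets \<open>S n\<close>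
  with \<open>f n\<close> constant on \<open>S n\<close>; on \<open>S n\<close> all of
  \<open>f 0, ..., f n\<close> are then constant.\<close>

lemma diagonal_choice:
  fixes f :: "nat \<Rightarrow> nat \<Rightarrow> 'c"
  assumes "\<And>n. finite (range (f n))"
  shows "\<exists>\<tau>. \<forall>n. infinite {m. \<forall>i\<le>n. f i m = \<tau> i}"
proof -
  have refine: "\<exists>T c. infinite T \<and> T \<subseteq> S \<and> (\<forall>m\<in>T. f n m = c)" if inf: "infinite S" for S n
  proof -
    have "finite (f n ` S)"
      using assms[of n] by (rule finite_subset[rotated]) auto
    then obtain m0 where "infinite {m \<in> S. f n m = f n m0}"
      using pigeonhole_infinite[OF inf] by blast
    then show ?thesis by (intro exI[of _ "{m \<in> S. f n m = f n m0}"]) auto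
  qed
  have "\<exists>S. \<forall>n. (infinite (S n) \<and> (\<exists>c. \<forall>m\<in>S n. f n m = c)) \<and> S (Suc n) \<subseteq> S n"
  proof (rule dependent_nat_choice)
    show "\<exists>S. infinite S \<and> (\<exists>c. \<forall>m\<in>S. f 0 m = c)"
      using refine[of UNIV 0] by auto
    show "\<exists>T. (infinite T \<and> (\<exists>c. \<forall>m\<in>T. f (Suc n) m = c)) \<and> T \<subseteq> S"
      if "infinite S \<and> (\<exists>c. \<forall>m\<in>S. f n m = c)" for S n
      using refine[of S "Suc n"] that by blast
  qed
  then obtain S where S: "\<And>n. infinite (S n)" "\<And>n. \<exists>c. \<forall>m\<in>S n. f n m = c"
    "\<And>n. S (Suc n) \<subseteq> S n" by blast
  obtain \<tau> where \<tau>: "\<And>n m. m \<in> S n \<Longrightarrow> f n m = \<tau> n"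
    using S(2) by metis
  have "S n \<subseteq> S i" if "i \<le> n" for i n
    using lift_Suc_antimono_le[of S, OF S(3) that] .
  then have "S n \<subseteq> {m. \<forall>i\<le>n. f i m = \<tau> i}" for n
    using \<tau> by blast
  then show ?thesis
    using S(1) by (meson finite_subset)
qed

section \<open>Fixed points of growing substitutions\<close>

locale growing_fixed_point =
  fixes B :: "'b set" and \<phi> :: "'b \<Rightarrow> 'b list" and z :: "nat \<Rightarrow> 'b"
  assumes finite_alphabet: "finite B" and growing: "growing_substitution B \<phi>"
    and z_in: "z n \<in> B" and fixed: "subst_seq \<phi> z = z"
begin

abbreviation \<sigma> where "\<sigma> n \<equiv> subst_word \<phi> ^^ n"

text \<open>\<open>bd n a\<close> is the position in \<open>z = \<phi>\<^sup>n(z)\<close> where the image of the \<open>a\<close>-th letter starts.\<close>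

definition bd :: "nat \<Rightarrow> nat \<Rightarrow> nat" where
  "bd n a = length (\<sigma> n (map z [0..<a]))"

lemma phi_in: "b \<in> B \<Longrightarrow> \<phi> b \<in> lists B"
  using growing by (auto simp: growing_substitution_def)

lemma pow_in_lists: "w \<in> lists B \<Longrightarrow> \<sigma> n w \<in> lists B"
  using phi_in by (rule subst_pow_in_lists)

lemma factor_in_lists: "map z [a..<b] \<in> lists B"
  using z_in by auto

lemma pow_length_ge: "w \<in> lists B \<Longrightarrow> length w \<le> length (\<sigma> n w)"
proof (induction n)
  case (Suc n)
  have "1 * length (\<sigma> n w) \<le> length (subst_word \<phi> (\<sigma> n w))"
    using growing_substitution_nonempty[OF growing] pow_in_lists Suc.prems
    by (intro length_subst_word_ge[where B = B]) (simp_all add: Suc_leI)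
  then show ?case
    using Suc by simp
qed simp

text \<open>\<open>subst_seq\<close> determines \<open>z i\<close> from the image of the first
  \<open>i + 1\<close> letters only. Images of prefixes extend one another, so every image long
  enough shows the same letter at \<open>i\<close>.\<close>

lemma pow_prefix: "\<sigma> n (map z [0..<a]) = map z [0..<bd n a]"
proof -
  have "\<exists>c. subst_word \<phi> (map z [0..<a]) = map z [0..<c]" for a
  proof -
    let ?P = "\<lambda>a. subst_word \<phi> (map z [0..<a])"
    have ext: "?P (a + d) ! i = ?P a ! i" if "i < length (?P a)" for a d i
    proof -
      have "?P (a + d) = ?P a @ subst_word \<phi> (map z [a..<a + d])"
        by (simp add: upt_add_eq_append[OF le0] subst_word_append)
      then show ?thesis using that by (simp add: nth_append)
    qed
    have "?P a = map z [0..<length (?P a)]"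
    proof (rule nth_equalityI)
      fix i assume i: "i < length (?P a)"
      have "i < length (?P (Suc i))"
        using pow_length_ge[OF factor_in_lists, of 0 "Suc i" 1] by simp
      then have "?P a ! i = ?P (Suc i) ! i"
        using ext[of i a "Suc i - a"] ext[of i "Suc i" "a - Suc i"] i
        by (cases "a \<le> Suc i") auto
      also have "\<dots> = z i"
        using fun_cong[OF fixed, of i] by (simp only: subst_seq_def)
      finally show "?P a ! i = map z [0..<length (?P a)] ! i"
        using i by simp
    qed simp
    then show ?thesis by blast
  qed
  note step = this
  have "\<exists>c. \<sigma> n (map z [0..<a]) = map z [0..<c]"
  proof (induction n)
    case 0
    then show ?case by auto
  next
    case (Suc n)
    then show ?case using step by (metis comp_apply funpow.simps(2))
  qed
  then show ?thesis
    by (auto simp: bd_def)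
qed

lemma bd_0: "bd n 0 = 0"
  by (simp add: bd_def subst_pow_Nil)

text \<open>The cut points of order \<open>n + d\<close> are among those of order \<open>n\<close>,
  so the factorizations of \<open>z\<close> into images refine each other.\<close>

lemma bd_add: "bd (n + d) a = bd n (bd d a)"
proof -
  have "\<sigma> (n + d) (map z [0..<a]) = \<sigma> n (map z [0..<bd d a])"
    by (simp add: funpow_add pow_prefix)
  then show ?thesis
    by (simp add: bd_def)
qed

lemma
  assumes "a \<le> b"
  shows pow_factor: "\<sigma> n (map z [a..<b]) = map z [bd n a..<bd n b]"
    and bd_split: "bd n b = bd n a + length (\<sigma> n (map z [a..<b]))"
proof -
  have "map z [0..<b] = map z [0..<a] @ map z [a..<b]"
    using assms by (simp add: upt_split[of 0 a b])
  then have *: "map z [0..<bd n b] = map z [0..<bd n a] @ \<sigma> n (map z [a..<b])"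
    by (metis pow_prefix subst_pow_append)
  from arg_cong[OF this, of length] show "bd n b = bd n a + length (\<sigma> n (map z [a..<b]))"
    by simp
  from arg_cong[OF *, of "drop (bd n a)"] show "\<sigma> n (map z [a..<b]) = map z [bd n a..<bd n b]"
    by (simp add: drop_map)
qed

lemma bd_growth:
  assumes "a \<le> b" "\<And>b. b \<in> B \<Longrightarrow> c \<le> length (\<sigma> n [b])"
  shows "bd n a + c * (b - a) \<le> bd n b"
  using bd_split[OF assms(1), of n] length_subst_pow_ge[of B c n \<phi> "map z [a..<b]"]
    assms(2) factor_in_lists
  by simp

lemma bd_less_iff: "bd n a < bd n b \<longleftrightarrow> a < b"
proof -
  have "bd n a < bd n b" if "a < b" for a b
    using bd_growth[of a b 1 n] pow_length_ge[of "[_]" n] that by fastforce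
  then show ?thesis
    by (metis linorder_neqE_nat order_less_asym)
qed

lemma level_exists: "\<exists>i. bd n i \<le> q \<and> q < bd n (Suc i)"
proof -
  have "q < bd n (Suc q)"
    using bd_growth[of 0 "Suc q" 1 n] pow_length_ge[of "[_]" n] by (auto simp: bd_0)
  define i where "i = (LEAST i. q < bd n (Suc i))"
  have "q < bd n (Suc i)"
    unfolding i_def by (rule LeastI) fact
  moreover have "bd n i \<le> q"
  proof (cases i)
    case (Suc j)
    then show ?thesis
      using not_less_Least[of j "\<lambda>i. q < bd n (Suc i)"] by (simp add: i_def)
  qed (simp add: bd_0)
  ultimately show ?thesis by blast
qed

definition level :: "nat \<Rightarrow> nat \<Rightarrow> nat" where
  "level n q = (SOME i. bd n i \<le> q \<and> q < bd n (Suc i))"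

lemma level: "bd n (level n q) \<le> q \<and> q < bd n (Suc (level n q))"
  using someI_ex[OF level_exists] by (simp_all add: level_def)

lemma level_pos: "bd n 1 \<le> q \<Longrightarrow> 0 < level n q"
  using level[of n q] by (cases "level n q") auto

text \<open>The form of the length predicate retains what the automatic case needs: for constant
  length \<open>k\<close> it forces all lengths to be \<open>k ^ p\<close>.\<close>

lemma limit_two_sided:
  fixes y :: "int \<Rightarrow> 'a"
  assumes y: "limit_at_infinity y (\<pi> \<circ> z)" and \<pi>: "\<pi> ` B \<subseteq> A"
  shows "\<exists>p w. 0 < p \<and> windows_in y w \<and> windows_in w y \<and>
    presented (\<lambda>l. \<exists>b\<in>B. l = length (\<sigma> p [b])) A (right_half w) \<and>
    presented (\<lambda>l. \<exists>b\<in>B. l = length (\<sigma> p [b])) A (left_half w)"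
proof -
  obtain q where q: "\<And>m. m \<le> q m"
    and yq: "\<And>m i. \<bar>i\<bar> \<le> int m \<Longrightarrow> y i = \<pi> (z (nat (int (q m) + i)))"
    using y unfolding limit_at_infinity_def comp_def by metis
  \<comment> \<open>Both neighbours are included since \<open>q m\<close> may lie at the edge of the
    image covering it. If \<open>level n (q m)\<close> is 0, truncated subtraction leaves two
    letters, hence a bound on the length below instead of an equation.\<close>
  define t where "t n m = map z [level n (q m) - 1..<level n (q m) + 2]" for n m
  have t_in: "t n m \<in> {l. set l \<subseteq> B \<and> length l \<le> 3}" for n m
    using z_in by (auto simp: t_def)
  have fin3: "finite {l. set l \<subseteq> B \<and> length l \<le> 3}"
    using finite_alphabet by (rule finite_lists_length_le)
  have "finite (range (t n))" for n
    by (rule finite_subset[OF _ fin3]) (use t_in in blast)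
  then obtain \<tau> where \<tau>: "\<And>n. infinite {m. \<forall>i\<le>n. t i m = \<tau> i}"
    using diagonal_choice[of t] by blast
  have pick: "\<exists>m\<ge>M. \<forall>i\<le>n. t i m = \<tau> i" for M n
    using \<tau>[of n] by (auto simp: infinite_nat_iff_unbounded_le)
  have \<tau>_in: "\<tau> n \<in> {l. set l \<subseteq> B \<and> length l \<le> 3}" for n
    using pick[of 0 n] t_in by (metis order_refl)

  have occurs: "\<exists>a. \<forall>r<length (\<sigma> n (\<tau> n)). y (a + int r) = \<pi> (\<sigma> n (\<tau> n) ! r)" for n
  proof -
    \<comment> \<open>The image of \<open>t n m\<close> contains position \<open>q m\<close>, so a
      window whose radius is at least its length contains all of it. The summand
      \<open>bd n 1\<close> makes the level positive, so the left neighbour exists.\<close>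
    obtain m where m: "bd n 1 + length (\<sigma> n (\<tau> n)) \<le> m" "t n m = \<tau> n"
      using pick by blast
    define l where "l = level n (q m)"
    have l: "0 < l" "bd n l \<le> q m" "q m < bd n (Suc l)"
      using level_pos[of n "q m"] level[of n "q m"] m(1) q[of m] by (auto simp: l_def)
    have eq: "\<sigma> n (\<tau> n) = map z [bd n (l - 1)..<bd n (l + 2)]"
      unfolding m(2)[symmetric] t_def l_def[symmetric] by (rule pow_factor) simp
    have "bd n (l - 1) < bd n l" "bd n (Suc l) < bd n (l + 2)"
      using l(1) by (simp_all add: bd_less_iff)
    then have "y (int (bd n (l - 1)) - int (q m) + int r) = \<pi> (\<sigma> n (\<tau> n) ! r)"
      if "r < length (\<sigma> n (\<tau> n))" for r
      using that yq[of "int (bd n (l - 1)) - int (q m) + int r" m] m(1) l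
      by (simp add: eq nat_add_distrib)
    then show ?thesis by blast
  qed

  have covered: "\<exists>N. \<forall>n\<ge>N. \<exists>a. \<forall>i. \<bar>i\<bar> \<le> int M \<longrightarrow>
      0 \<le> a + i \<and> a + i < int (length (\<sigma> n (\<tau> n))) \<and> y i = \<pi> (\<sigma> n (\<tau> n) ! nat (a + i))" for M
  proof -
    \<comment> \<open>The centre lies in the middle image; for such \<open>n\<close> the outer two
      images are longer than the radius \<open>M\<close>.\<close>
    obtain N where N: "\<And>n b. n \<ge> N \<Longrightarrow> b \<in> B \<Longrightarrow> Suc M \<le> length (\<sigma> n [b])"
      using growing_substitution_uniform[OF growing finite_alphabet] by blast
    have "\<exists>a. \<forall>i. \<bar>i\<bar> \<le> int M \<longrightarrow>
      0 \<le> a + i \<and> a + i < int (length (\<sigma> n (\<tau> n))) \<and> y i = \<pi> (\<sigma> n (\<tau> n) ! nat (a + i))"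
      if "n \<ge> N" for n
    proof -
      obtain m where m: "bd n 1 + M \<le> m" "t n m = \<tau> n"
        using pick by blast
      define l where "l = level n (q m)"
      have l: "0 < l" "bd n l \<le> q m" "q m < bd n (Suc l)"
        using level_pos[of n "q m"] level[of n "q m"] m(1) q[of m] by (auto simp: l_def)
      have eq: "\<sigma> n (\<tau> n) = map z [bd n (l - 1)..<bd n (l + 2)]"
        unfolding m(2)[symmetric] t_def l_def[symmetric] by (rule pow_factor) simp
      have g: "bd n (l - 1) + Suc M \<le> bd n l" "bd n (Suc l) + Suc M \<le> bd n (l + 2)"
        using bd_growth[of "l - 1" l "Suc M" n] bd_growth[of "Suc l" "l + 2" "Suc M" n] N[OF that] l(1)
        by auto
      define a where "a = int (q m) - int (bd n (l - 1))"
      have "0 \<le> a + i \<and> a + i < int (length (\<sigma> n (\<tau> n))) \<and> y i = \<pi> (\<sigma> n (\<tau> n) ! nat (a + i))"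
        if i: "\<bar>i\<bar> \<le> int M" for i
      proof -
        have b: "0 \<le> a + i" "a + i < int (length (\<sigma> n (\<tau> n)))"
          using g l i by (simp_all add: a_def eq)
        have "bd n (l - 1) + nat (a + i) = nat (int (q m) + i)"
          using b(1) by (simp add: a_def)
        then have "\<sigma> n (\<tau> n) ! nat (a + i) = z (nat (int (q m) + i))"
          using b by (simp add: eq)
        then show ?thesis
          using b yq[of i m] i m(1) by simp
      qed
      then show ?thesis by blast
    qed
    then show ?thesis by blast
  qed

  have nested: "\<exists>u v. u \<noteq> [] \<and> v \<noteq> [] \<and> \<sigma> d (\<tau> (n + d)) = u @ \<tau> n @ v"
    if d: "\<And>b. b \<in> B \<Longrightarrow> 2 \<le> length (\<sigma> d [b])" for n d
  proof -
    obtain m where m: "bd n 1 + bd (n + d) 1 \<le> m" "\<forall>i\<le>n + d. t i m = \<tau> i"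
      using pick by blast
    define l where "l = level n (q m)"
    define k where "k = level (n + d) (q m)"
    have l: "0 < l" "bd n l \<le> q m" "q m < bd n (Suc l)"
      using level_pos[of n "q m"] level[of n "q m"] m(1) q[of m] by (auto simp: l_def)
    have k: "0 < k" "bd (n + d) k \<le> q m" "q m < bd (n + d) (Suc k)"
      using level_pos[of "n + d" "q m"] level[of "n + d" "q m"] m(1) q[of m] by (auto simp: k_def)
    \<comment> \<open>Both intervals contain \<open>q m\<close> and hence overlap. Cancelling
      \<open>bd n\<close> places letter \<open>l\<close> inside the \<open>d\<close>-fold image of
      letter \<open>k\<close>; neighbouring images of length at least 2 leave a letter to spare
      beyond \<open>l - 1\<close> and \<open>l + 1\<close>.\<close>
    have "bd n (bd d k) < bd n (Suc l)" "bd n l < bd n (bd d (Suc k))"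
      using k l by (simp_all add: bd_add)
    then have kl: "bd d k < Suc l" "l < bd d (Suc k)"
      by (simp_all add: bd_less_iff)
    have eq: "\<sigma> d (\<tau> (n + d)) = map z [bd d (k - 1)..<bd d (k + 2)]"
      using m(2)[rule_format, of "n + d"] pow_factor[of "k - 1" "k + 2" d]
      by (simp add: t_def k_def)
    have eq': "\<tau> n = map z [l - 1..<l + 2]"
      using m(2)[rule_format, of n] by (simp add: t_def l_def)
    have g: "bd d (k - 1) + 2 \<le> bd d k" "bd d (Suc k) + 2 \<le> bd d (k + 2)"
      using bd_growth[of "k - 1" k 2 d] bd_growth[of "Suc k" "k + 2" 2 d] d k(1) by auto
    have "[bd d (k - 1)..<bd d (k + 2)] = [bd d (k - 1)..<l - 1] @ [l - 1..<l + 2] @ [l + 2..<bd d (k + 2)]"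
      using g kl upt_split[of "bd d (k - 1)" "l - 1" "bd d (k + 2)"]
        upt_split[of "l - 1" "l + 2" "bd d (k + 2)"] by simp
    then show ?thesis
      using g kl eq eq'
      by (intro exI[of _ "map z [bd d (k - 1)..<l - 1]"] exI[of _ "map z [l + 2..<bd d (k + 2)]"]) auto
  qed

  have "finite (range \<tau>)"
    by (rule finite_subset[OF _ fin3]) (use \<tau>_in in blast)
  then obtain n' where "infinite {n \<in> UNIV. \<tau> n = \<tau> n'}"
    using pigeonhole_infinite[of UNIV \<tau>] by auto
  then obtain s where s: "infinite {n. \<tau> n = s}"
    by auto
  then obtain n0 where n0: "\<tau> n0 = s"
    using infinite_imp_nonempty by blast
  have sB: "s \<in> lists B"
    using \<tau>_in[of n0] n0 by auto
  obtain P where P: "\<And>d b. d \<ge> P \<Longrightarrow> b \<in> B \<Longrightarrow> 2 \<le> length (\<sigma> d [b])"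
    using growing_substitution_uniform[OF growing finite_alphabet] by blast
  obtain n1 where n1: "n1 \<ge> Suc (n0 + P)" "\<tau> n1 = s"
    using s by (auto simp: infinite_nat_iff_unbounded_le)
  \<comment> \<open>The distance is at least \<open>P\<close>, so that images under the
    \<open>p\<close>-th power have length at least 2, as \<open>nested\<close> and the recoding by
    windows demand.\<close>
  define p where "p = n1 - n0"
  have p: "0 < p" "P \<le> p" "n0 + p = n1"
    using n1(1) by (auto simp: p_def)
  obtain u v where uv: "u \<noteq> []" "v \<noteq> []" "\<sigma> p s = u @ s @ v"
    using nested[of p n0] P[OF p(2)] p(3) n0 n1(2) by auto
  have "finite ((\<lambda>n. n mod p) ` {n. \<tau> n = s})"
    by (rule finite_subset[of _ "{..<p}"]) (use p in auto)
  then obtain n2 where n2: "infinite {n \<in> {n. \<tau> n = s}. n mod p = n2 mod p}"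
    using pigeonhole_infinite[OF s] by blast
  have prog: "\<exists>j\<ge>J. \<tau> (p * j + n2) = s" for J
  proof -
    obtain n where n: "n \<ge> p * J + n2" "\<tau> n = s" "n mod p = n2 mod p"
      using n2 by (auto simp: infinite_nat_iff_unbounded_le)
    then have "p dvd n - n2"
      using mod_eq_dvd_iff_nat[of n2 n p] by simp
    then obtain j where j: "n = n2 + p * j"
      using n(1) by (metis add_leD2 dvdE le_add_diff_inverse)
    then have "J \<le> j"
      using n(1) p(1) by simp
    then show ?thesis
      using n(2) j by (auto simp: add.commute)
  qed
  define \<psi> where "\<psi> b = \<sigma> p [b]" for b
  have \<psi>_word: "subst_word \<psi> w = \<sigma> p w" for w
    unfolding \<psi>_def by (rule subst_word_of_pow)
  \<comment> \<open>Starting from \<open>\<sigma> n2 s\<close> instead of \<open>s\<close> makes the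
    \<open>j\<close>-th word equal to \<open>\<sigma> n (\<tau> n)\<close> with
    \<open>n = p * j + n2\<close> for infinitely many \<open>j\<close>, by
    \<open>prog\<close>.\<close>
  have \<psi>_pow: "(subst_word \<psi> ^^ j) (\<sigma> n2 s) = \<sigma> (p * j + n2) s" for j
    unfolding \<psi>_def subst_pow_of_pow by (simp add: funpow_add)
  have uvB: "u \<in> lists B" "v \<in> lists B"
    using pow_in_lists[OF sB, of p] uv(3) by auto
  have "subst_word \<psi> (\<sigma> n2 s) = \<sigma> n2 (\<sigma> p s)"
    unfolding \<psi>_word by (metis add.commute comp_apply funpow_add)
  then have fixw: "subst_word \<psi> (\<sigma> n2 s) = \<sigma> n2 u @ \<sigma> n2 s @ \<sigma> n2 v"
    by (simp add: uv(3) subst_pow_append)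
  have \<psi>2: "2 \<le> length (\<psi> b)" if "b \<in> B" for b
    using P[OF p(2) that] by (simp add: \<psi>_def)
  have \<psi>B: "\<psi> b \<in> lists B" if "b \<in> B" for b
    unfolding \<psi>_def using that by (intro pow_in_lists) simp
  have ne: "\<sigma> n2 u \<noteq> []" "\<sigma> n2 v \<noteq> []"
    using pow_length_ge[OF uvB(1), of n2] pow_length_ge[OF uvB(2), of n2] uv(1,2) by auto
  have \<psi>ne: "\<psi> b \<noteq> []" if "b \<in> B" for b
    using \<psi>2[OF that] by auto
  obtain W :: "int \<Rightarrow> 'b" and g c where W: "\<And>i. W i \<in> B"
    "\<And>i. g (i + 1) = g i + int (length (\<psi> (W i)))"
    "\<And>i r. r < length (\<psi> (W i)) \<Longrightarrow> W (g i + int r) = \<psi> (W i) ! r"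
    "\<And>j::nat. j \<le> c j"
    "\<And>j. c j + j \<le> length (\<sigma> (p * j + n2) s)"
    "\<And>j r. r < length (\<sigma> (p * j + n2) s) \<Longrightarrow> W (int r - int (c j)) = \<sigma> (p * j + n2) s ! r"
    by (rule two_sided_fixed_point[of B \<psi>, OF \<psi>B \<psi>ne pow_in_lists[OF sB] fixw ne, unfolded \<psi>_pow])
      blast+
  have "windows_in y (\<pi> \<circ> W)"
    unfolding windows_in_def
  proof
    fix M
    obtain N where N: "\<forall>n\<ge>N. \<exists>a. \<forall>i. \<bar>i\<bar> \<le> int M \<longrightarrow>
      0 \<le> a + i \<and> a + i < int (length (\<sigma> n (\<tau> n))) \<and> y i = \<pi> (\<sigma> n (\<tau> n) ! nat (a + i))"
      using covered by blast
    obtain j where j: "j \<ge> N" "\<tau> (p * j + n2) = s"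
      using prog by blast
    have "N \<le> p * j + n2"
      using j(1) p(1) by (simp add: Suc_leI trans_le_add1 order_trans[of N j])
    then obtain a where a: "\<And>i. \<bar>i\<bar> \<le> int M \<Longrightarrow> 0 \<le> a + i \<and>
        a + i < int (length (\<sigma> (p * j + n2) s)) \<and> y i = \<pi> (\<sigma> (p * j + n2) s ! nat (a + i))"
      using N j(2) by metis
    have "y i = (\<pi> \<circ> W) (a - int (c j) + i)" if "\<bar>i\<bar> \<le> int M" for i
    proof -
      have r: "nat (a + i) < length (\<sigma> (p * j + n2) s)"
        using a[OF that] by linarith
      show ?thesis
        using a[OF that] W(6)[OF r] by (simp add: algebra_simps)
    qed
    then show "\<exists>q. \<forall>i. \<bar>i\<bar> \<le> int M \<longrightarrow> y i = (\<pi> \<circ> W) (q + i)"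
      by blast
  qed
  moreover have "windows_in (\<pi> \<circ> W) y"
    unfolding windows_in_def
  proof
    fix M
    obtain j where j: "j \<ge> Suc M" "\<tau> (p * j + n2) = s"
      using prog by blast
    obtain a where a: "\<And>r. r < length (\<sigma> (p * j + n2) s) \<Longrightarrow>
        y (a + int r) = \<pi> (\<sigma> (p * j + n2) s ! r)"
      using occurs[of "p * j + n2"] j(2) by auto
    have "(\<pi> \<circ> W) i = y (a + int (c j) + i)" if "\<bar>i\<bar> \<le> int M" for i
    proof -
      have r: "nat (int (c j) + i) < length (\<sigma> (p * j + n2) s)" "0 \<le> int (c j) + i"
        using that j(1) W(4)[of j] W(5)[of j] by linarith+
      then show ?thesis
        using a[OF r(1)] W(6)[OF r(1)] by (simp add: algebra_simps)
    qed
    then show "\<exists>q. \<forall>i. \<bar>i\<bar> \<le> int M \<longrightarrow> (\<pi> \<circ> W) i = y (q + i)"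
      by blast
  qed
  moreover have "presented (\<lambda>l. \<exists>b\<in>B. l = length (\<sigma> p [b])) A (right_half (\<pi> \<circ> W))"
    by (rule presented_right_half[OF finite_alphabet W(1-3)]) (use W(1) \<psi>2 \<pi> in \<open>auto simp: \<psi>_def\<close>)
  moreover have "presented (\<lambda>l. \<exists>b\<in>B. l = length (\<sigma> p [b])) A (left_half (\<pi> \<circ> W))"
    by (rule presented_left_half[OF finite_alphabet W(1-3)]) (use W(1) \<psi>2 \<pi> in \<open>auto simp: \<psi>_def\<close>)
  ultimately show ?thesis
    using p(1) by blast
qed

end

section \<open>Substitutive and automatic limits\<close>

lemma presentedE:
  assumes "presented Q A x"
  obtains B :: "nat set" and \<phi> z \<pi> where "growing_fixed_point B \<phi> z"
    "\<And>b. b \<in> B \<Longrightarrow> Q (length (\<phi> b))" "\<pi> ` B \<subseteq> A" "x = \<pi> \<circ> z"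
proof -
  obtain B :: "nat set" and \<phi> z \<pi> where *: "finite B" "growing_substitution B \<phi>"
    "\<forall>b\<in>B. Q (length (\<phi> b))" "range z \<subseteq> B" "subst_seq \<phi> z = z" "\<pi> ` B \<subseteq> A" "x = \<pi> \<circ> z"
    using assms unfolding presented_def by blast
  moreover from * have "growing_fixed_point B \<phi> z"
    by unfold_locales auto
  ultimately show thesis
    using that by blast
qed

lemma presented_in: "presented Q A x \<Longrightarrow> x n \<in> A"
  by (elim presentedE) (auto dest: growing_fixed_point.z_in)

lemma presented_mono:
  assumes "presented Q A x" "\<And>l. Q l \<Longrightarrow> Q' l"
  shows "presented Q' A x"
proof -
  obtain B :: "nat set" and \<phi> z \<pi> where "finite B" "growing_substitution B \<phi>"
    "\<forall>b\<in>B. Q (length (\<phi> b))" "range z \<subseteq> B" "subst_seq \<phi> z = z" "\<pi> ` B \<subseteq> A" "x = \<pi> \<circ> z"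
    using assms(1) unfolding presented_def by blast
  moreover from this have "\<forall>b\<in>B. Q' (length (\<phi> b))"
    using assms(2) by blast
  ultimately show ?thesis
    unfolding presented_def by blast
qed

section \<open>Constant length and powers of the base\<close>

lemma length_subst_word_uniform:
  assumes "\<And>b. b \<in> B \<Longrightarrow> length (\<phi> b) = k" "w \<in> lists B"
  shows "length (subst_word \<phi> w) = k * length w"
  using assms(2) by (induction w) (simp_all add: subst_word_Nil subst_word_Cons assms(1))

lemma length_subst_pow_uniform:
  assumes "\<And>b. b \<in> B \<Longrightarrow> \<phi> b \<in> lists B" "\<And>b. b \<in> B \<Longrightarrow> length (\<phi> b) = k" "w \<in> lists B"
  shows "length ((subst_word \<phi> ^^ n) w) = k ^ n * length w"
proof (induction n)
  case (Suc n)
  have "(subst_word \<phi> ^^ n) w \<in> lists B"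
    using assms(1,3) by (rule subst_pow_in_lists)
  then show ?case
    using length_subst_word_uniform[of B \<phi> k] assms(2) Suc by simp
qed simp

text \<open>One refinement by \<open>k ^ p\<close> is split into \<open>p\<close> refinements by
  \<open>k\<close>: the recoded letter at \<open>n\<close> remembers the letters of \<open>z\<close>
  at all intermediate positions \<open>k ^ s * n + r\<close>.\<close>

lemma automatic_of_power:
  assumes x: "automatic (k ^ p) A x" and k: "2 \<le> k" and p: "0 < p"
  shows "automatic k A x"
proof -
  obtain B :: "nat set" and \<phi> z \<pi> where fp: "growing_fixed_point B \<phi> z"
    and len: "\<And>b. b \<in> B \<Longrightarrow> length (\<phi> b) = k ^ p" and \<pi>: "\<pi> ` B \<subseteq> A" and x: "x = \<pi> \<circ> z"
    using x unfolding automatic_iff_presented by (rule presentedE) (rule that)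
  interpret growing_fixed_point B \<phi> z by (fact fp)
  have bd: "bd 1 a = k ^ p * a" for a
    using length_subst_word_uniform[of B \<phi> "k ^ p" "map z [0..<a]"] len factor_in_lists
    by (simp add: bd_def)
  have z: "z (k ^ p * n + r) = \<phi> (z n) ! r" if "r < k ^ p" for n r
  proof -
    have "\<phi> (z n) = map z [k ^ p * n..<k ^ p * Suc n]"
      using pow_factor[of n "Suc n" 1] by (simp add: bd[simplified] subst_word_def)
    then show ?thesis using that by simp
  qed
  have "finite {(s, r). s < p \<and> r < k ^ s}"
    by (rule finite_subset[of _ "SIGMA s:{..<p}. {..<k ^ s}"]) auto
  then obtain ps where ps: "set ps = {(s, r). s < p \<and> r < k ^ s}"
    using finite_list by blast
  \<comment> \<open>the entry \<open>(s, r)\<close> of \<open>v (k * n + j)\<close> is the entry \<open>(s + 1, k\<^sup>s j + r)\<close> of \<open>v n\<close>, or a letter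
    of \<open>\<phi> (z n)\<close> if \<open>s + 1 = p\<close>\<close>
  define v where "v n = map (\<lambda>(s, r). z (k ^ s * n + r)) ps" for n
  have v_eq: "v n = v m \<longleftrightarrow> (\<forall>s<p. \<forall>r<k ^ s. z (k ^ s * n + r) = z (k ^ s * m + r))" for n m
    by (auto simp: v_def ps)
  have v0: "z n = z m" if "v n = v m" for n m
    using that[unfolded v_eq, rule_format, of 0 0] p by simp
  have "finite (range v)"
  proof (rule finite_subset)
    show "range v \<subseteq> {l. set l \<subseteq> B \<and> length l = length ps}"
      using z_in by (auto simp: v_def)
  qed (use finite_alphabet finite_lists_length_eq in blast)
  then have "presented (\<lambda>l. l = k) A x"
  proof (rule presented_of_self_similar[where h = "\<lambda>n. k * n" and L = "\<lambda>_. k"])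
    show "v (k * n + j) = v (k * m + j)" if eq: "v n = v m" and j: "j < k" for n m j
      unfolding v_eq
    proof (intro allI impI)
      fix s r assume s: "s < p" and r: "r < k ^ s"
      define i where "i = k ^ s * j + r"
      have "i < k ^ s * Suc j"
        using r by (simp add: i_def)
      also have "\<dots> \<le> k ^ Suc s"
        using j by (simp add: mult.commute[of k] Suc_leI del: mult_Suc_right)
      finally have i: "i < k ^ Suc s" .
      have pos: "k ^ s * (k * n + j) + r = k ^ Suc s * n + i" for n
        by (simp add: i_def algebra_simps)
      show "z (k ^ s * (k * n + j) + r) = z (k ^ s * (k * m + j) + r)"
      proof (cases "Suc s < p")
        case True
        then show ?thesis
          unfolding pos using eq[unfolded v_eq] i by blast
      next
        case False
        then have "p = Suc s"
          using s by simp
        then show ?thesis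
          unfolding pos using z[of i] i v0[OF eq] by simp
      qed
    qed
    show "x n \<in> A" for n
      using \<pi> z_in by (auto simp: x)
    show "x n = x m" if "v n = v m" for n m
      using v0[OF that] by (simp add: x)
  qed (use k in auto)
  then show ?thesis
    by (simp add: automatic_iff_presented)
qed

lemma substitutive_limit:
  assumes "substitutive A x" "limit_at_infinity y x"
  shows "\<exists>w. substitutive A (right_half w) \<and> substitutive A (left_half w) \<and>
    windows_in y w \<and> windows_in w y"
proof -
  obtain B :: "nat set" and \<phi> z \<pi> where fp: "growing_fixed_point B \<phi> z"
    and \<pi>: "\<pi> ` B \<subseteq> A" and x: "x = \<pi> \<circ> z"
    using assms(1) unfolding substitutive_iff_presented by (rule presentedE)
  show ?thesis
    using growing_fixed_point.limit_two_sided[OF fp assms(2)[unfolded x] \<pi>]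
    unfolding substitutive_iff_presented by (auto intro: presented_mono)
qed

lemma automatic_limit:
  assumes "automatic k A x" "limit_at_infinity y x"
  shows "\<exists>w. automatic k A (right_half w) \<and> automatic k A (left_half w) \<and>
    windows_in y w \<and> windows_in w y"
proof -
  obtain B :: "nat set" and \<phi> z \<pi> where fp: "growing_fixed_point B \<phi> z"
    and len: "\<And>b. b \<in> B \<Longrightarrow> length (\<phi> b) = k" and \<pi>: "\<pi> ` B \<subseteq> A" and x: "x = \<pi> \<circ> z"
    using assms(1) unfolding automatic_iff_presented by (rule presentedE) (rule that)
  interpret growing_fixed_point B \<phi> z by (fact fp)
  have pow_len: "length (\<sigma> n [b]) = k ^ n" if "b \<in> B" for n b
    using length_subst_pow_uniform[of B \<phi> k "[b]" n] phi_in len that by simp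
  \<comment> \<open>Growth excludes \<open>k = 0\<close> and \<open>k = 1\<close>.\<close>
  obtain N where "2 \<le> length (\<sigma> N [z 0])"
    using growing_substitution_uniform[OF growing finite_alphabet, of 2] z_in by blast
  then have "2 \<le> k ^ N"
    by (simp add: pow_len z_in)
  then have k: "2 \<le> k"
    by (cases "k = 0 \<or> k = 1") (auto simp: power_0_left split: if_splits)
  obtain p w where p: "0 < p" and w: "windows_in y w" "windows_in w y"
    and pres: "presented (\<lambda>l. \<exists>b\<in>B. l = length (\<sigma> p [b])) A (right_half w)"
      "presented (\<lambda>l. \<exists>b\<in>B. l = length (\<sigma> p [b])) A (left_half w)"
    using limit_two_sided[OF assms(2)[unfolded x] \<pi>] by blast
  have "automatic (k ^ p) A (right_half w)" "automatic (k ^ p) A (left_half w)"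
    unfolding automatic_iff_presented
    by (rule presented_mono[OF pres(1)], use pow_len in auto)
      (rule presented_mono[OF pres(2)], use pow_len in auto)
  then show ?thesis
    using automatic_of_power[OF _ k p] w by blast
qed

section \<open>Orbit closures\<close>

text \<open>Basic open sets of the product topology restrict finitely many coordinates, all of which
  lie in some central window; conversely, prescribing a central window is an open condition.\<close>

lemma orbit_closure_iff:
  assumes y: "range y \<subseteq> A"
  shows "x \<in> orbit_closure A y \<longleftrightarrow> range x \<subseteq> A \<and> windows_in x y"
proof
  assume x: "x \<in> orbit_closure A y"
  have xA: "range x \<subseteq> A"
    using x closure_of_subset_topspace[of "full_shift A"]
    unfolding orbit_closure_def topspace_full_shift by blast
  moreover have "windows_in x y"
    unfolding windows_in_def
  proof
    fix m :: nat
    let ?I = "{i :: int. \<bar>i\<bar> \<le> int m}"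
    let ?X = "\<lambda>i. if i \<in> ?I then {x i} else A"
    let ?U = "PiE UNIV ?X"
    have "?I = {- int m..int m}"
      by auto
    then have "finite ?I"
      by simp
    then have "openin (full_shift A) ?U"
      unfolding full_shift_def using xA
      by (intro product_topology_basis) (auto intro: finite_subset[of _ ?I])
    moreover have "x \<in> ?U"
      using xA by auto
    ultimately obtain q where "shift_pow q y \<in> ?U"
      using x unfolding orbit_closure_def in_closure_of by blast
    then have *: "shift_pow q y i \<in> ?X i" for i
      by (auto simp: PiE_iff)
    have "x i = y (q + i)" if "\<bar>i\<bar> \<le> int m" for i
      using *[of i] that by (simp add: shift_pow_def add.commute)
    then show "\<exists>q. \<forall>i. \<bar>i\<bar> \<le> int m \<longrightarrow> x i = y (q + i)"
      by blast
  qed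
  ultimately show "range x \<subseteq> A \<and> windows_in x y" ..
next
  assume x: "range x \<subseteq> A \<and> windows_in x y"
  have "\<exists>q. shift_pow q y \<in> U" if U: "openin (full_shift A) U" "x \<in> U" for U
  proof -
    obtain X where X: "x \<in> PiE UNIV X" "finite {i. X i \<noteq> A}" "PiE UNIV X \<subseteq> U"
      using product_topology_open_contains_basis[OF U[unfolded full_shift_def]] by auto
    define m where "m = Max (insert 0 ((\<lambda>i. nat \<bar>i\<bar>) ` {i. X i \<noteq> A}))"
    have m: "\<bar>i\<bar> \<le> int m" if "X i \<noteq> A" for i
    proof -
      have "nat \<bar>i\<bar> \<le> m"
        unfolding m_def using X(2) that by (intro Max_ge) auto
      then show ?thesis by simp
    qed
    obtain q where q: "\<And>i. \<bar>i\<bar> \<le> int m \<Longrightarrow> x i = y (q + i)"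
      using x unfolding windows_in_def by blast
    have "shift_pow q y i \<in> X i" for i
    proof (cases "X i = A")
      case False
      then show ?thesis
        using q[OF m] X(1) by (metis PiE_E UNIV_I add.commute shift_pow_def)
    qed (use y in \<open>auto simp: shift_pow_def\<close>)
    then have "shift_pow q y \<in> U"
      using X(3) by (auto simp: PiE_iff)
    then show ?thesis by blast
  qed
  then show "x \<in> orbit_closure A y"
    using x unfolding orbit_closure_def in_closure_of topspace_full_shift by blast
qed

lemma windows_in_trans: "windows_in x y \<Longrightarrow> windows_in y w \<Longrightarrow> windows_in x w"
proof -
  assume xy: "windows_in x y" and yw: "windows_in y w"
  show ?thesis
    unfolding windows_in_def
  proof
    fix m :: nat
    obtain q where q: "\<And>i. \<bar>i\<bar> \<le> int m \<Longrightarrow> x i = y (q + i)"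
      using xy unfolding windows_in_def by blast
    obtain r where r: "\<And>i. \<bar>i\<bar> \<le> int (m + nat \<bar>q\<bar>) \<Longrightarrow> y i = w (r + i)"
      using yw unfolding windows_in_def by blast
    have "x i = w (r + q + i)" if "\<bar>i\<bar> \<le> int m" for i
      using q[OF that] r[of "q + i"] that by (simp add: algebra_simps)
    then show "\<exists>q. \<forall>i. \<bar>i\<bar> \<le> int m \<longrightarrow> x i = w (q + i)"
      by blast
  qed
qed

lemma orbit_closure_eq:
  assumes "range y \<subseteq> A" "range w \<subseteq> A" "windows_in y w" "windows_in w y"
  shows "orbit_closure A y = orbit_closure A w"
  using assms windows_in_trans by (auto simp: orbit_closure_iff)

section \<open>Reflection and the three kinds of limits of shifts\<close>

text \<open>The reflection is about -1/2, not 0, so that it exchanges the two halves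
  exactly.\<close>

definition reflect :: "(int \<Rightarrow> 'a) \<Rightarrow> int \<Rightarrow> 'a" where
  "reflect y = (\<lambda>i. y (- 1 - i))"

lemma windows_in_reflect:
  assumes "windows_in x y"
  shows "windows_in (reflect x) (reflect y)"
  unfolding windows_in_def
proof
  fix m :: nat
  \<comment> \<open>Reflection moves the centre of a window by one, so the radius grows by
    one.\<close>
  obtain q where q: "\<And>i. \<bar>i\<bar> \<le> int (Suc m) \<Longrightarrow> x i = y (q + i)"
    using assms unfolding windows_in_def by blast
  have "reflect x i = reflect y (- q + i)" if "\<bar>i\<bar> \<le> int m" for i
    using q[of "- 1 - i"] that by (simp add: reflect_def algebra_simps)
  then show "\<exists>q. \<forall>i. \<bar>i\<bar> \<le> int m \<longrightarrow> reflect x i = reflect y (q + i)"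
    by blast
qed

lemma reflect_reflect: "reflect (reflect y) = y"
  by (simp add: reflect_def)

lemma right_half_reflect: "right_half (reflect y) = left_half y"
  and left_half_reflect: "left_half (reflect y) = right_half y"
  by (simp_all add: reflect_def right_half_def left_half_def)

text \<open>If neither limit exists, the offsets at which large windows of \<open>x\<close> match
  \<open>y\<close> are bounded on both sides. One offset then recurs for arbitrarily large windows
  and hence matches everywhere.\<close>

lemma windows_in_cases:
  assumes "windows_in x y"
  obtains q where "x = shift_pow q y"
  | "limit_at_infinity x (right_half y)"
  | "limit_at_infinity (reflect x) (left_half y)"
proof -
  define match where "match m q \<longleftrightarrow> (\<forall>i. \<bar>i\<bar> \<le> int m \<longrightarrow> x i = y (q + i))" for m q
  have mono: "match m' q" if "match m q" "m' \<le> m" for m m' q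
    using that by (auto simp: match_def)
  have "\<exists>q. x = shift_pow q y"
    if R: "\<not> limit_at_infinity x (right_half y)" and L: "\<not> limit_at_infinity (reflect x) (left_half y)"
  proof -
    obtain a where a: "\<And>q. q \<ge> a \<Longrightarrow> \<exists>i. \<bar>i\<bar> \<le> int a \<and> x i \<noteq> right_half y (nat (int q + i))"
      using R unfolding limit_at_infinity_def by blast
    obtain b where b: "\<And>q. q \<ge> b \<Longrightarrow> \<exists>i. \<bar>i\<bar> \<le> int b \<and> reflect x i \<noteq> left_half y (nat (int q + i))"
      using L unfolding limit_at_infinity_def by blast
    have q_less: "q < int a" if "match a q" for q
    proof (rule ccontr)
      assume q: "\<not> q < int a"
      then have "x i = right_half y (nat (int (nat q) + i))" if "\<bar>i\<bar> \<le> int a" for i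
      proof -
        have "0 \<le> q + i"
          using q that by linarith
        then show ?thesis
          using \<open>match a q\<close> that q by (simp add: match_def right_half_def)
      qed
      then show False
        using a[of "nat q"] q by force
    qed
    have q_gr: "- int b < q" if "match (Suc b) q" for q
    proof (rule ccontr)
      assume q: "\<not> - int b < q"
      then have "reflect x i = left_half y (nat (int (nat (- q)) + i))" if "\<bar>i\<bar> \<le> int b" for i
      proof -
        have "0 \<le> i - q"
          using q that by linarith
        then show ?thesis
          using \<open>match (Suc b) q\<close>[unfolded match_def, rule_format, of "- 1 - i"] that q
          by (simp add: reflect_def left_half_def algebra_simps)
      qed
      then show False
        using b[of "nat (- q)"] q by force
    qed
    obtain Q where Q: "\<And>m. match m (Q m)"
      using assms unfolding windows_in_def match_def by metis
    have "Q m \<in> {- int b..int a}" if "m \<ge> max a (Suc b)" for m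
    proof -
      have "match a (Q m)" "match (Suc b) (Q m)"
        using mono[OF Q[of m]] that by simp_all
      then show ?thesis
        using q_less[of "Q m"] q_gr[of "Q m"] by simp
    qed
    then have "Q ` {max a (Suc b)..} \<subseteq> {- int b..int a}"
      by (intro image_subsetI) simp
    then have "finite (Q ` {max a (Suc b)..})"
      by (rule finite_subset) simp
    then obtain m0 where "infinite {m \<in> {max a (Suc b)..}. Q m = Q m0}"
      using pigeonhole_infinite[OF infinite_Ici] by blast
    then have "\<exists>m\<ge>M. Q m = Q m0" for M
      by (auto simp: infinite_nat_iff_unbounded_le)
    then have "match M (Q m0)" for M
      using Q mono by metis
    then have "x i = y (Q m0 + i)" for i
      unfolding match_def by (metis abs_ge_zero nat_0_le order_refl)
    then have "x = shift_pow (Q m0) y"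
      by (simp add: shift_pow_def fun_eq_iff add.commute)
    then show ?thesis ..
  qed
  then show thesis
    using that by blast
qed

text \<open>\<open>P\<close> stands for being substitutive or \<open>k\<close>-automatic. The halves
  of the generator \<open>x\<close> of \<open>Y\<close> need not satisfy \<open>P\<close>; it is
  replaced by some \<open>w\<close> whose windows occur in \<open>x\<close> and conversely, which
  has the same orbit closure.\<close>

lemma transitive_subsystem:
  assumes lim: "\<And>x y. P x \<Longrightarrow> limit_at_infinity y x \<Longrightarrow>
      \<exists>w. P (right_half w) \<and> P (left_half w) \<and> windows_in y w \<and> windows_in w y"
    and P_in: "\<And>x n. P x \<Longrightarrow> x n \<in> A"
    and P: "P (right_half y)" "P (left_half y)"
    and Y: "subsystem A Y (orbit_closure A y)" "transitive_system A Y"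
  shows "\<exists>w. P (right_half w) \<and> P (left_half w) \<and> Y = orbit_closure A w"
proof -
  have range: "range w \<subseteq> A" if "P (right_half w)" "P (left_half w)" for w
  proof -
    have "w i \<in> A" for i
      using P_in[OF that(1), of "nat i"] P_in[OF that(2), of "nat (- 1 - i)"]
      by (cases "0 \<le> i") (simp_all add: right_half_def left_half_def)
    then show ?thesis by blast
  qed
  obtain x where x: "x \<in> Y" "Y = orbit_closure A x"
    using Y(2) by (auto simp: transitive_system_def)
  then have "x \<in> orbit_closure A y"
    using Y(1) by (auto simp: subsystem_def)
  then have xA: "range x \<subseteq> A" and xy: "windows_in x y"
    using orbit_closure_iff[OF range[OF P]] by auto
  have "\<exists>w. P (right_half w) \<and> P (left_half w) \<and> windows_in x w \<and> windows_in w x"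
    using xy
  proof (cases rule: windows_in_cases)
    case (1 q)
    then have "windows_in y x"
      by (auto simp: windows_in_def shift_pow_def intro!: exI[of _ "- q"])
    then show ?thesis
      using P xy by blast
  next
    case 2
    then show ?thesis
      using lim[OF P(1)] by blast
  next
    case 3
    then obtain w where w: "P (right_half w)" "P (left_half w)"
      "windows_in (reflect x) w" "windows_in w (reflect x)"
      using lim[OF P(2)] by blast
    then have "windows_in x (reflect w)" "windows_in (reflect w) x"
      using windows_in_reflect reflect_reflect by metis+
    then show ?thesis
      using w by (intro exI[of _ "reflect w"]) (simp add: right_half_reflect left_half_reflect)
  qed
  then show ?thesis
    using x(2) orbit_closure_eq[OF xA range] by metis
qed

theorem theorem2p9:
  fixes A :: "'a set"
  assumes "finite A"
  shows "(\<forall>X Y. two_sided_substitutive_system A X \<and> subsystem A Y X \<and> transitive_system A Y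
            \<longrightarrow> two_sided_substitutive_system A Y) \<and>
         (\<forall>k X Y. two_sided_automatic_system k A X \<and> subsystem A Y X \<and> transitive_system A Y
            \<longrightarrow> two_sided_automatic_system k A Y)"
proof (intro conjI allI impI)
  fix X Y assume *: "two_sided_substitutive_system A X \<and> subsystem A Y X \<and> transitive_system A Y"
  then obtain y where y: "substitutive A (right_half y)" "substitutive A (left_half y)"
    "X = orbit_closure A y"
    by (auto simp: two_sided_substitutive_system_def two_sided_substitutive_def)
  have "\<exists>w. substitutive A (right_half w) \<and> substitutive A (left_half w) \<and> Y = orbit_closure A w"
    using * y(3)
    by (intro transitive_subsystem[where P = "substitutive A", OF substitutive_limit _ y(1,2)])
      (auto simp: substitutive_iff_presented presented_in)
  then show "two_sided_substitutive_system A Y"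
    by (simp add: two_sided_substitutive_system_def two_sided_substitutive_def conj_assoc)
next
  fix k X Y assume *: "two_sided_automatic_system k A X \<and> subsystem A Y X \<and> transitive_system A Y"
  then obtain y where y: "automatic k A (right_half y)" "automatic k A (left_half y)"
    "X = orbit_closure A y"
    by (auto simp: two_sided_automatic_system_def two_sided_automatic_def)
  have "\<exists>w. automatic k A (right_half w) \<and> automatic k A (left_half w) \<and> Y = orbit_closure A w"
    using * y(3)
    by (intro transitive_subsystem[where P = "automatic k A", OF automatic_limit _ y(1,2)])
      (auto simp: automatic_iff_presented presented_in)
  then show "two_sided_automatic_system k A Y"
    by (simp add: two_sided_automatic_system_def two_sided_automatic_def conj_assoc)
qed

end
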